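(* Let $k\ge 1$ and $r\geq 1$ be integers. Let $\{b_{k,n}^{(r)}\}_{n\ge 0}$ be the $r$-times iterated binomial transform of the $k$-Lucas sequence and let $\{c_{k,n}^{(r)}\}_{n\ge 0}$ be the $r$-times iterated binomial transform of the $k$-Fibonacci sequence. Then for every integer $n>0$, $$b_{k,n}^{(r)}=c_{k,n+1}^{(r)}-(r^{2}+kr-1)\,c_{k,n-1}^{(r)}.$$
   Context: The $k$-Lucas sequence $\{L_{k,n}\}_{n\ge 0}$ is defined by $L_{k,0}=2$, $L_{k,1}=k$ and $L_{k,n+1}=kL_{k,n}+L_{k,n-1}$ for $n\ge 1$. The $k$-Fibonacci sequence $\{F_{k,n}\}_{n\ge 0}$ is defined by $F_{k,0}=0$, $F_{k,1}=1$ and $F_{k,n+1}=kF_{k,n}+F_{k,n-1}$ for $n\ge 1$. The binomial transform of a sequence $\{x_0,x_1,x_2,\ldots\}$ is the sequence $\{b_n\}$ with $b_n=\sum_{i=0}^{n}\binom{n}{i}x_i$. The sequences $\{b_{k,n}^{(r)}\}$ and $\{c_{k,n}^{(r)}\}$ are obtained by applying the binomial transform $r$ times to the $k$-Lucas and $k$-Fibonacci sequences respectively, i.e. $b_{k,n}^{(0)}=L_{k,n}$, $c_{k,n}^{(0)}=F_{k,n}$, and $b_{k,n}^{(r)}=\sum_{i=0}^{n}\binom{n}{i}b_{k,i}^{(r-1)}$, $c_{k,n}^{(r)}=\sum_{i=0}^{n}\binom{n}{i}c_{k,i}^{(r-1)}$ for $r\ge 1$. *)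

theory Defs
  imports Main
begin

fun k_lucas :: "int \<Rightarrow> nat \<Rightarrow> int" where
  "k_lucas k 0 = 2"
| "k_lucas k (Suc 0) = k"
| "k_lucas k (Suc (Suc n)) = k * k_lucas k (Suc n) + k_lucas k n"

fun k_fibonacci :: "int \<Rightarrow> nat \<Rightarrow> int" where
  "k_fibonacci k 0 = 0"
| "k_fibonacci k (Suc 0) = 1"
| "k_fibonacci k (Suc (Suc n)) = k * k_fibonacci k (Suc n) + k_fibonacci k n"

definition binomial_transform :: "(nat \<Rightarrow> int) \<Rightarrow> nat \<Rightarrow> int" where
  "binomial_transform x n = (\<Sum>i=0..n. int (n choose i) * x i)"

definition lucas_transform :: "int \<Rightarrow> nat \<Rightarrow> nat \<Rightarrow> int" where
  "lucas_transform k r = (binomial_transform ^^ r) (k_lucas k)"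

definition fibonacci_transform :: "int \<Rightarrow> nat \<Rightarrow> nat \<Rightarrow> int" where
  "fibonacci_transform k r = (binomial_transform ^^ r) (k_fibonacci k)"

end

theory Submission
  imports Defs
begin

text \<open>
  Pascal's rule says that the binomial transform \<open>B\<close> intertwines the shift \<open>E\<close>, which takes
  \<open>x\<^sub>n\<close> to \<open>x\<^sub>n\<^sub>+\<^sub>1\<close>, with \<open>E - 1\<close>: one has \<open>B E = (E - 1) B\<close>
  (\<open>binomial_transform_shift\<close>). Since \<open>B\<close> is linear, every linear relation with constant
  coefficients between sequences and their shifts is carried by \<open>B\<close> to the relation with
  \<open>E\<close> replaced by \<open>E - 1\<close>, and by \<open>r\<close> iterations to the relation with \<open>E\<close> replaced by
  \<open>E - r\<close>.

  Two relations suffice. The Fibonacci recurrence \<open>(E\<^sup>2 - k E - 1) F = 0\<close> becomes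
  \<open>((E - r)\<^sup>2 - k (E - r) - 1) c = 0\<close>, in which \<open>E\<close> has coefficient \<open>-(k + 2 r)\<close> and the
  constant term is \<open>r\<^sup>2 + k r - 1\<close>. The identity \<open>L = (2 E - k) F\<close> becomes
  \<open>b = (2 E - (k + 2 r)) c\<close>. In the resulting formula
  \<open>b\<^sub>n = 2 c\<^sub>n\<^sub>+\<^sub>1 - (k + 2 r) c\<^sub>n\<close>, one of the two copies of \<open>c\<^sub>n\<^sub>+\<^sub>1\<close> is expanded by the
  recurrence, which cancels the term in \<open>c\<^sub>n\<close> and leaves the claim.
\<close>

text \<open>
  Pascal's rule splits the sum at index \<open>n + 1\<close> into one over \<open>n choose i\<close> and one over
  \<open>n choose (i - 1)\<close>; the latter is the transform of the shifted sequence.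
\<close>

lemma binomial_transform_shift:
  "binomial_transform (\<lambda>i. x (Suc i)) n = binomial_transform x (Suc n) - binomial_transform x n"
proof -
  have "binomial_transform x (Suc n) = x 0 + (\<Sum>i\<le>n. int (Suc n choose Suc i) * x (Suc i))"
    unfolding binomial_transform_def atLeast0AtMost
    by (simp only: sum.atMost_Suc_shift binomial_n_0 of_nat_1 mult_1)
  also have "\<dots> = (x 0 + (\<Sum>i\<le>n. int (n choose Suc i) * x (Suc i)))
      + (\<Sum>i\<le>n. int (n choose i) * x (Suc i))"
    by (simp add: sum.distrib distrib_right)
  \<comment> \<open>The extra index \<open>Suc n\<close> contributes nothing, as \<open>n choose Suc n\<close> vanishes.\<close>
  also have "x 0 + (\<Sum>i\<le>n. int (n choose Suc i) * x (Suc i))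
      = (\<Sum>i\<le>Suc n. int (n choose i) * x i)"
    by (simp only: sum.atMost_Suc_shift binomial_n_0 of_nat_1 mult_1)
  also have "\<dots> = (\<Sum>i\<le>n. int (n choose i) * x i)"
    by simp
  finally show ?thesis
    by (simp add: binomial_transform_def atLeast0AtMost)
qed

lemma binomial_transform_linear:
  "binomial_transform (\<lambda>i. a * x i + b * y i) n
    = a * binomial_transform x n + b * binomial_transform y n"
  by (simp add: binomial_transform_def sum.distrib sum_distrib_left algebra_simps)

text \<open>
  If \<open>x\<close> is annihilated by \<open>E\<^sup>2 - p E - q\<close>, its transform is annihilated by
  \<open>(E - 1)\<^sup>2 - p (E - 1) - q\<close>.
\<close>

lemma binomial_transform_recurrence:
  assumes "\<And>n. x (Suc (Suc n)) = p * x (Suc n) + q * x n"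
  shows "binomial_transform x (Suc (Suc n))
    = (p + 2) * binomial_transform x (Suc n) + (q - p - 1) * binomial_transform x n"
proof -
  have "binomial_transform (\<lambda>i. x (Suc (Suc i))) n
      = p * binomial_transform (\<lambda>i. x (Suc i)) n + q * binomial_transform x n"
    by (simp only: assms binomial_transform_linear)
  moreover have "binomial_transform (\<lambda>i. x (Suc (Suc i))) n
      = binomial_transform (\<lambda>i. x (Suc i)) (Suc n) - binomial_transform (\<lambda>i. x (Suc i)) n"
    by (rule binomial_transform_shift)
  ultimately show ?thesis
    by (simp add: binomial_transform_shift algebra_simps)
qed

lemma fibonacci_transform_Suc:
  "fibonacci_transform k (Suc r) = binomial_transform (fibonacci_transform k r)"
  by (simp add: fibonacci_transform_def)

lemma lucas_transform_Suc:
  "lucas_transform k (Suc r) = binomial_transform (lucas_transform k r)"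
  by (simp add: lucas_transform_def)

lemma fibonacci_transform_recurrence:
  "fibonacci_transform k r (Suc (Suc n))
    = (k + 2 * int r) * fibonacci_transform k r (Suc n)
      + (1 - k * int r - (int r)\<^sup>2) * fibonacci_transform k r n"
proof (induction r arbitrary: n)
  case 0
  show ?case
    by (simp add: fibonacci_transform_def)
next
  case (Suc r)
  show ?case
    unfolding fibonacci_transform_Suc
    unfolding binomial_transform_recurrence [where x = "fibonacci_transform k r", OF Suc.IH]
    by (simp add: power2_eq_square algebra_simps)
qed

lemma k_lucas_eq_k_fibonacci:
  "k_lucas k n = 2 * k_fibonacci k (Suc n) - k * k_fibonacci k n"
  by (induction k n rule: k_lucas.induct) (simp_all add: algebra_simps)

text \<open>
  Unlike the identity of the theorem, this relation holds from \<open>n = 0\<close> on and only uses forward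
  shifts, so it passes through each transform.
\<close>

lemma lucas_transform_eq_fibonacci_transform:
  "lucas_transform k r n
    = 2 * fibonacci_transform k r (Suc n) - (k + 2 * int r) * fibonacci_transform k r n"
proof (induction r arbitrary: n)
  case 0
  show ?case
    by (simp add: lucas_transform_def fibonacci_transform_def k_lucas_eq_k_fibonacci)
next
  case (Suc r)
  have "lucas_transform k r
      = (\<lambda>n. 2 * fibonacci_transform k r (Suc n) + (- (k + 2 * int r)) * fibonacci_transform k r n)"
    by (rule ext) (simp only: Suc.IH diff_conv_add_uminus mult_minus_left)
  then have "lucas_transform k (Suc r) n
      = 2 * binomial_transform (\<lambda>i. fibonacci_transform k r (Suc i)) n
        + (- (k + 2 * int r)) * fibonacci_transform k (Suc r) n"
    by (simp only: lucas_transform_Suc fibonacci_transform_Suc binomial_transform_linear)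
  then show ?case
    by (simp add: binomial_transform_shift fibonacci_transform_Suc algebra_simps)
qed

theorem theorem2p4:
  fixes k :: int and r n :: nat
  assumes "k \<ge> 1" and "r \<ge> 1" and "n > 0"
  shows "lucas_transform k r n =
    fibonacci_transform k r (n + 1)
      - ((int r)^2 + k * int r - 1) * fibonacci_transform k r (n - 1)"
proof -
  obtain m where n: "n = Suc m"
    using \<open>n > 0\<close> gr0_implies_Suc by blast
  show ?thesis
    unfolding n lucas_transform_eq_fibonacci_transform
    by (simp add: fibonacci_transform_recurrence algebra_simps)
qed

end
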